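(* Let $\tau$ be in the upper half-plane and let $\xi\in\mathbb{C}$ satisfy $|\Im(\xi/\tau)|<-\Im(1/\tau)$. Then $$P_-(\tau,\xi)-P_+(\tau,\xi)=2i\sum_{n=1}^\infty\frac{\sin\frac{2n\xi\pi}{\tau}}{n\,(e^{2n\pi i/\tau}-1)}.$$
   Context: For $d\in(-\pi,0)\cup(0,\pi)$ define $$P^d(\tau,\xi)=\int_0^{\infty e^{id}}\frac{\sin\bigl(\frac{\xi}{\tau}t\bigr)}{e^{it/\tau}-1}\Bigl(\cot\frac t2-\frac2t\Bigr)\frac{dt}{t},$$ the integral being along the half-line from $0$ with argument $d$; $P^d$ is analytic on $\Omega^d=\bigcup_{\sigma\in(0,\pi)}\bigl(0,\infty e^{i(d+\sigma)}\bigr)\times\{\xi\in\mathbb{C}:|\Im(\xi e^{-i\sigma})|<\sin\sigma\}$ (here $(0,\infty e^{i\theta})$ is the open ray of argument $\theta$ and $\tau$ ranges over the Riemann surface of the logarithm). $P_-$ denotes the analytic function on $\Omega_-=\{\arg\tau\in(-\pi,\pi)\}\times\bigl(\mathbb{C}\setminus((-\infty,-1]\cup[1,\infty))\bigr)$ that agrees with $P^d$ on $\Omega^d$ for every $d\in(-\pi,0)$, and $P_+$ denotes the analytic function on $\Omega_+=\{\arg\tau\in(0,2\pi)\}\times\bigl(\mathbb{C}\setminus((-\infty,-1]\cup[1,\infty))\bigr)$ that agrees with $P^d$ on $\Omega^d$ for every $d\in(0,\pi)$. *)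

theory Defs
  imports "HOL-Analysis.Analysis"
begin

definition ray_integral :: "real \<Rightarrow> (complex \<Rightarrow> complex) \<Rightarrow> complex" where
  "ray_integral d f = integral {0..} (\<lambda>r::real. f (of_real r * cis d) * cis d)"

definition P_ray :: "real \<Rightarrow> complex \<Rightarrow> complex \<Rightarrow> complex" where
  "P_ray d \<tau> \<xi> = ray_integral d
     (\<lambda>t. sin (\<xi> / \<tau> * t) / (exp (\<i> * t / \<tau>) - 1) * (cot (t / 2) - 2 / t) / t)"

text \<open>
  The variable \<open>\<tau>\<close> lives on the Riemann surface of the logarithm. For \<open>-\<pi> < d < 0\<close> all
  arguments \<open>d + \<sigma>\<close> lie in \<open>(-\<pi>, \<pi>)\<close>, and for \<open>0 < d < \<pi>\<close> they lie in \<open>(0, 2\<pi>)\<close>. Each of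
  these sectors projects injectively to the complex plane, and \<open>P_ray\<close> depends only on the
  projection, so within each of the two families \<open>\<tau>\<close> is represented by its projection. Points
  with argument in \<open>(0, \<pi>)\<close> belong to both sectors and project to the upper half-plane.
\<close>

definition Omega :: "real \<Rightarrow> (complex \<times> complex) set" where
  "Omega d = {(of_real r * cis (d + \<sigma>), \<xi>) | r \<sigma> \<xi>.
     0 < r \<and> 0 < \<sigma> \<and> \<sigma> < pi \<and> \<bar>Im (\<xi> * cis (- \<sigma>))\<bar> < sin \<sigma>}"

definition cut_plane :: "complex set" where
  "cut_plane = - complex_of_real ` ({..-1} \<union> {1..})"

definition Omega_minus :: "(complex \<times> complex) set" where
  "Omega_minus = {of_real r * cis \<theta> | r \<theta>. 0 < r \<and> - pi < \<theta> \<and> \<theta> < pi} \<times> cut_plane"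

definition Omega_plus :: "(complex \<times> complex) set" where
  "Omega_plus = {of_real r * cis \<theta> | r \<theta>. 0 < r \<and> 0 < \<theta> \<and> \<theta> < 2 * pi} \<times> cut_plane"

text \<open>Joint complex differentiability; on an open set this is analyticity in two variables.\<close>

definition analytic2_on :: "(complex \<times> complex \<Rightarrow> complex) \<Rightarrow> (complex \<times> complex) set \<Rightarrow> bool" where
  "analytic2_on F S \<longleftrightarrow> (\<forall>z\<in>S. \<exists>a b. (F has_derivative (\<lambda>(h, k). a * h + b * k)) (at z))"

text \<open>
  Analyticity is required on the union of the sets \<open>Omega d\<close>. On the larger set
  \<open>Omega_minus\<close> (resp. \<open>Omega_plus\<close>) it would be unsatisfiable: for fixed non-real \<open>\<tau>\<close> the
  \<open>\<xi>\<close>-derivative of the glued function is unbounded near \<open>\<xi> = 1 + \<tau>\<close> (resp. \<open>\<xi> = 1 - \<tau>\<close>),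
  as one sees by expanding \<open>1 / (exp (\<i> * t / \<tau>) - 1)\<close> and \<open>cot (t / 2)\<close> in exponentials, and this
  point lies in \<open>cut_plane\<close>. By \<open>is_P_minusI\<close> and \<open>is_P_plusI\<close> below the present condition is
  implied by the one with the larger domain, so results assuming it are the stronger ones.
\<close>

definition is_P_minus :: "(complex \<times> complex \<Rightarrow> complex) \<Rightarrow> bool" where
  "is_P_minus F \<longleftrightarrow> analytic2_on F (\<Union>d\<in>{- pi<..<0}. Omega d) \<and>
     (\<forall>d\<in>{- pi<..<0}. \<forall>(\<tau>, \<xi>)\<in>Omega d. F (\<tau>, \<xi>) = P_ray d \<tau> \<xi>)"

definition is_P_plus :: "(complex \<times> complex \<Rightarrow> complex) \<Rightarrow> bool" where
  "is_P_plus F \<longleftrightarrow> analytic2_on F (\<Union>d\<in>{0<..<pi}. Omega d) \<and>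
     (\<forall>d\<in>{0<..<pi}. \<forall>(\<tau>, \<xi>)\<in>Omega d. F (\<tau>, \<xi>) = P_ray d \<tau> \<xi>)"

lemma strip_subset_cut_plane:
  assumes "0 < \<sigma>" "\<sigma> < pi" "\<bar>Im (\<xi> * cis (- \<sigma>))\<bar> < sin \<sigma>"
  shows "\<xi> \<in> cut_plane"
proof (rule ccontr)
  assume "\<xi> \<notin> cut_plane"
  then obtain x where x: "\<xi> = of_real x" "\<bar>x\<bar> \<ge> 1"
    by (auto simp: cut_plane_def)
  have s: "sin \<sigma> > 0"
    using assms by (simp add: sin_gt_zero)
  have "\<bar>Im (\<xi> * cis (- \<sigma>))\<bar> = \<bar>x\<bar> * sin \<sigma>"
    using s by (simp add: x abs_mult)
  moreover have "1 * sin \<sigma> \<le> \<bar>x\<bar> * sin \<sigma>"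
    using s x by (intro mult_right_mono) auto
  ultimately show False
    using assms by simp
qed

lemma Omega_subset_Omega_minus:
  assumes "d \<in> {- pi<..<0}"
  shows "Omega d \<subseteq> Omega_minus"
proof
  fix z assume "z \<in> Omega d"
  then obtain r \<sigma> \<xi> where z: "z = (of_real r * cis (d + \<sigma>), \<xi>)" "0 < r" "0 < \<sigma>" "\<sigma> < pi"
    "\<bar>Im (\<xi> * cis (- \<sigma>))\<bar> < sin \<sigma>"
    unfolding Omega_def by blast
  have "- pi < d + \<sigma>" "d + \<sigma> < pi"
    using assms z by auto
  then show "z \<in> Omega_minus"
    unfolding Omega_minus_def using z strip_subset_cut_plane by blast
qed

lemma Omega_subset_Omega_plus:
  assumes "d \<in> {0<..<pi}"
  shows "Omega d \<subseteq> Omega_plus"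
proof
  fix z assume "z \<in> Omega d"
  then obtain r \<sigma> \<xi> where z: "z = (of_real r * cis (d + \<sigma>), \<xi>)" "0 < r" "0 < \<sigma>" "\<sigma> < pi"
    "\<bar>Im (\<xi> * cis (- \<sigma>))\<bar> < sin \<sigma>"
    unfolding Omega_def by blast
  have "0 < d + \<sigma>" "d + \<sigma> < 2 * pi"
    using assms z by auto
  then show "z \<in> Omega_plus"
    unfolding Omega_plus_def using z strip_subset_cut_plane by blast
qed

lemma is_P_minusI:
  assumes "analytic2_on F Omega_minus"
    and "\<And>d \<tau> \<xi>. d \<in> {- pi<..<0} \<Longrightarrow> (\<tau>, \<xi>) \<in> Omega d \<Longrightarrow> F (\<tau>, \<xi>) = P_ray d \<tau> \<xi>"
  shows "is_P_minus F"
  using assms Omega_subset_Omega_minus unfolding is_P_minus_def analytic2_on_def by blast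

lemma is_P_plusI:
  assumes "analytic2_on F Omega_plus"
    and "\<And>d \<tau> \<xi>. d \<in> {0<..<pi} \<Longrightarrow> (\<tau>, \<xi>) \<in> Omega d \<Longrightarrow> F (\<tau>, \<xi>) = P_ray d \<tau> \<xi>"
  shows "is_P_plus F"
  using assms Omega_subset_Omega_plus unfolding is_P_plus_def analytic2_on_def by blast

end

theory Submission
  imports Defs "HOL-Complex_Analysis.Complex_Analysis"
begin

text \<open>
  For small \<open>d > 0\<close> the point \<open>(\<tau>, \<xi>)\<close> lies in both \<open>Omega (- d)\<close> and \<open>Omega d\<close>, so the
  left-hand side is the difference of the integrals along the rays of arguments \<open>- d\<close> and \<open>d\<close>. The
  strip condition on \<open>\<xi>\<close> is precisely what makes \<open>sin (\<xi> t / \<tau>) / (exp (\<i> t / \<tau>) - 1)\<close> analytic and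
  exponentially decaying in the sector between these rays. Closing the two rays by the vertical line
  \<open>Re t = (2 N + 1) \<pi>\<close>, on which \<open>cot (t / 2)\<close> is bounded by 1, the residue theorem turns the
  difference into the sum of the residues at the poles \<open>2 \<pi> n\<close> of \<open>cot (t / 2)\<close>; the singularity
  at the vertex 0 is removable.
\<close>

section \<open>Bounds for the complex sine and cotangent\<close>

lemma norm_cos_squared_sinh:
  fixes z :: complex
  shows "norm (cos z) ^ 2 = cos (Re z) ^ 2 + sinh (Im z) ^ 2"
  by (simp add: norm_cos_squared sinh_field_def exp_minus power_divide)

lemma norm_sin_squared_sinh:
  fixes z :: complex
  shows "norm (sin z) ^ 2 = sin (Re z) ^ 2 + sinh (Im z) ^ 2"
  using norm_cos_squared_sinh[of "of_real pi / 2 - z"] by (simp add: cos_diff sin_diff)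

lemma norm_sin_le_exp_Im:
  fixes z :: complex
  shows "norm (sin z) \<le> exp \<bar>Im z\<bar>"
proof -
  have "norm (sin z) ^ 2 \<le> cosh (Im z) ^ 2"
    by (simp add: norm_sin_squared_sinh cosh_square_eq abs_square_le_1)
  then have "norm (sin z) \<le> cosh (Im z)"
    by (rule power2_le_imp_le) simp
  also have "\<dots> \<le> exp \<bar>Im z\<bar>"
    by (simp add: cosh_field_def abs_if)
  finally show ?thesis .
qed

lemma norm_cot_le_1:
  fixes z :: complex
  assumes "cos (Re z) = 0"
  shows "norm (cot z) \<le> 1"
proof -
  have "norm (cos z) ^ 2 \<le> norm (sin z) ^ 2"
    by (simp add: norm_cos_squared_sinh norm_sin_squared_sinh assms)
  then have "norm (cos z) \<le> norm (sin z)"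
    by (rule power2_le_imp_le) simp
  then show ?thesis
    by (simp add: cot_def norm_divide divide_le_eq_1)
qed

lemma norm_cot_le:
  fixes z :: complex
  assumes "Im z \<noteq> 0"
  shows "norm (cot z) \<le> 1 + 1 / \<bar>Im z\<bar>"
proof -
  define s where "s = \<bar>sinh (Im z)\<bar>"
  have s: "\<bar>Im z\<bar> \<le> s"
    using real_le_abs_sinh[of "Im z"] by (simp add: s_def sinh_field_def exp_minus)
  with assms have "0 < s" by linarith
  have "norm (cos z) ^ 2 \<le> 1 + s\<^sup>2"
    by (simp add: norm_cos_squared_sinh s_def abs_square_le_1)
  also have "\<dots> \<le> (1 + s)\<^sup>2"
    using \<open>0 < s\<close> by (simp add: power2_sum)
  finally have cos: "norm (cos z) \<le> 1 + s"
    by (rule power2_le_imp_le) (use \<open>0 < s\<close> in simp)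
  have "s\<^sup>2 \<le> norm (sin z) ^ 2"
    by (simp add: norm_sin_squared_sinh s_def)
  then have sin: "s \<le> norm (sin z)"
    by (rule power2_le_imp_le) simp
  have "norm (cot z) \<le> (1 + s) / s"
    unfolding cot_def norm_divide using cos sin \<open>0 < s\<close> by (intro frac_le) auto
  also have "\<dots> = 1 + 1 / s"
    using \<open>0 < s\<close> by (simp add: field_simps)
  also have "\<dots> \<le> 1 + 1 / \<bar>Im z\<bar>"
    using s assms by (simp add: frac_le)
  finally show ?thesis .
qed

lemma sin_neq_0_if_cos_Re_eq_0:
  fixes z :: complex
  assumes "cos (Re z) = 0"
  shows "sin z \<noteq> 0"
proof -
  have "sin (Re z) ^ 2 = 1"
    using assms sin_cos_squared_add[of "Re z"] by simp
  then have "1 \<le> norm (sin z) ^ 2"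
    by (simp add: norm_sin_squared_sinh)
  then show ?thesis by auto
qed

lemma sin_half_eq_0_iff:
  fixes t :: complex
  shows "sin (t / 2) = 0 \<longleftrightarrow> (\<exists>m::int. t = of_real (2 * pi * m))"
proof -
  have "t / 2 = of_real (m * pi) \<longleftrightarrow> t = of_real (2 * pi * m)" for m :: int
    by (auto simp: field_simps)
  then show ?thesis
    by (simp add: sin_eq_0)
qed

section \<open>Integrals along rays\<close>

lemma absolutely_integrable_on_exp_decay:
  fixes h :: "real \<Rightarrow> 'a::euclidean_space"
  assumes cont: "continuous_on {a..} h" and "0 < \<delta>"
    and bound: "\<And>r. b \<le> r \<Longrightarrow> norm (h r) \<le> C * exp (- \<delta> * r)"
  shows "h absolutely_integrable_on {a..}"
proof -
  let ?m = "max a b"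
  have "h absolutely_integrable_on {a..?m}"
    by (intro absolutely_integrable_continuous_real continuous_on_subset[OF cont]) auto
  moreover have "h absolutely_integrable_on {?m..}"
  proof (rule measurable_bounded_by_integrable_imp_absolutely_integrable)
    show "h \<in> borel_measurable (lebesgue_on {?m..})"
      by (intro continuous_imp_measurable_on_sets_lebesgue continuous_on_subset[OF cont]) auto
    show "(\<lambda>r. C * exp (- \<delta> * r)) integrable_on {?m..}"
      by (intro integrable_on_mult_right integrable_on_exp_minus_to_infinity assms)
  qed (use bound in auto)
  ultimately have "h absolutely_integrable_on {a..?m} \<union> {?m..}"
    by (rule absolutely_integrable_Un)
  moreover have "{a..?m} \<union> {?m..} = {a..}"
    by auto
  ultimately show ?thesis
    by simp
qed

lemma tendsto_integral_at_top:
  fixes h :: "real \<Rightarrow> 'a::euclidean_space"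
  assumes "h absolutely_integrable_on {a..}"
  shows "((\<lambda>R. integral {a..R} h) \<longlongrightarrow> integral {a..} h) at_top"
proof -
  have "((\<lambda>R. LINT x:{a..R}|lebesgue. h x) \<longlongrightarrow> (LINT x:{a..}|lebesgue. h x)) at_top"
    by (rule tendsto_set_lebesgue_integral_at_top) (use assms in auto)
  moreover have "(LINT x:{a..R}|lebesgue. h x) = integral {a..R} h" for R
    by (intro set_lebesgue_integral_eq_integral set_integrable_subset[OF assms]) auto
  ultimately show ?thesis
    using set_lebesgue_integral_eq_integral(2)[OF assms] by simp
qed

lemma contour_integral_linepath_ray:
  assumes "0 < R" and "continuous_on {0..R} (\<lambda>r. f (of_real r * cis \<phi>))"
  shows "contour_integral (linepath 0 (of_real R * cis \<phi>)) f =
         integral {0..R} (\<lambda>r. f (of_real r * cis \<phi>) * cis \<phi>)"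
proof -
  let ?h = "\<lambda>r. f (of_real r * cis \<phi>) * cis \<phi>"
  have "(?h has_integral integral {0..R} ?h) {0..R}"
    using assms by (intro integrable_integral integrable_continuous_real continuous_intros)
  from has_integral_stretch_real[OF this, of R]
  have "((\<lambda>x. ?h (R * x)) has_integral (1 / R) *\<^sub>R integral {0..R} ?h) {0..1}"
    using assms by simp
  from has_integral_mult_right[OF this, of "of_real R"]
  have "((\<lambda>x. f (linepath 0 (of_real R * cis \<phi>) x) * (of_real R * cis \<phi> - 0))
          has_integral integral {0..R} ?h) {0..1}"
    using assms by (simp add: linepath_def scaleR_conv_of_real mult_ac)
  then show ?thesis
    by (intro contour_integral_unique) (simp add: has_contour_integral_linepath)
qed

lemma contour_integral_linepath_tendsto_ray_integral:
  assumes cont: "continuous_on {0..} (\<lambda>r. f (of_real r * cis \<phi>))" and "0 < \<delta>"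
    and bound: "\<And>r. b \<le> r \<Longrightarrow> norm (f (of_real r * cis \<phi>)) \<le> C * exp (- \<delta> * r)"
  shows "((\<lambda>R. contour_integral (linepath 0 (of_real R * cis \<phi>)) f) \<longlongrightarrow> ray_integral \<phi> f) at_top"
proof -
  let ?h = "\<lambda>r. f (of_real r * cis \<phi>) * cis \<phi>"
  have "?h absolutely_integrable_on {0..}"
    by (rule absolutely_integrable_on_exp_decay[of _ _ \<delta> b C])
      (use assms in \<open>auto simp: norm_mult intro!: continuous_intros\<close>)
  then have "((\<lambda>R. integral {0..R} ?h) \<longlongrightarrow> ray_integral \<phi> f) at_top"
    unfolding ray_integral_def by (rule tendsto_integral_at_top)
  moreover have "\<forall>\<^sub>F R in at_top.
      integral {0..R} ?h = contour_integral (linepath 0 (of_real R * cis \<phi>)) f"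
    using eventually_gt_at_top[of 0]
    by eventually_elim
      (rule contour_integral_linepath_ray[symmetric], auto intro: continuous_on_subset[OF cont])
  ultimately show ?thesis
    by (rule Lim_transform_eventually)
qed

lemma ray_integral_spike_0:
  assumes "\<And>r. 0 < r \<Longrightarrow> f (of_real r * cis \<phi>) = g (of_real r * cis \<phi>)"
  shows "ray_integral \<phi> f = ray_integral \<phi> g"
  unfolding ray_integral_def by (rule integral_spike[of "{0}"]) (use assms in auto)

section \<open>Residues in a triangle\<close>

lemma convex_open_between:
  fixes K :: "'a::euclidean_space set"
  assumes "compact K" "convex K" "open U" "K \<subseteq> U"
  obtains S where "open S" "convex S" "K \<subseteq> S" "S \<subseteq> U"
proof (cases "K = {}")
  case True
  then show ?thesis by (intro that[of "{}"]) auto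
next
  case False
  then obtain \<epsilon> where \<epsilon>: "0 < \<epsilon>" "{x. infdist x K \<le> \<epsilon>} \<subseteq> U"
    using compact_in_open_separated assms by metis
  let ?S = "\<Union>x\<in>K. \<Union>y\<in>ball 0 \<epsilon>. {x + y}"
  show ?thesis
  proof (rule that)
    show "open ?S" by (intro open_sums) auto
    show "convex ?S" by (intro convex_sums assms convex_ball)
    show "K \<subseteq> ?S" using \<epsilon>(1) by force
    have "infdist (x + y) K \<le> \<epsilon>" if "x \<in> K" "y \<in> ball 0 \<epsilon>" for x y
      using infdist_le[OF that(1), of "x + y"] that(2) by (simp add: dist_norm)
    then show "?S \<subseteq> U" using \<epsilon>(2) by blast
  qed
qed

lemma winding_number_triangle_ccw:
  assumes "0 < Im ((b - a) * cnj (b - c))" and z: "z \<in> interior (convex hull {a, b, c})"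
  shows "winding_number (linepath a b +++ linepath b c +++ linepath c a) z = 1"
proof -
  have "z \<in> convex hull {a, b, c}" and off: "z \<notin> closed_segment a b"
    using z interior_of_triangle[of a b c] by auto
  then obtain u v w where uvw: "0 \<le> u" "0 \<le> v" "0 \<le> w" "u + v + w = 1"
    and z_eq: "z = u *\<^sub>R a + v *\<^sub>R b + w *\<^sub>R c"
    by (auto simp: convex_hull_3)
  have "w \<noteq> 0"
  proof
    assume "w = 0"
    then have "z = (1 - v) *\<^sub>R a + v *\<^sub>R b" "v \<le> 1"
      using uvw by (auto simp: z_eq simp flip: eq_diff_eq)
    then have "z \<in> closed_segment a b"
      using uvw(2) by (auto simp: closed_segment_def)
    with off show False by contradiction
  qed
  have "b - z = of_real u * (b - a) + of_real w * (b - c)"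
  proof -
    have "of_real (u + v + w) * b = b" by (simp only: uvw) simp
    then show ?thesis by (simp add: z_eq scaleR_conv_of_real algebra_simps)
  qed
  then have "Im ((b - a) * cnj (b - z)) = w * Im ((b - a) * cnj (b - c))"
    by (simp only:) (simp add: algebra_simps)
  then show ?thesis
    using winding_number_triangle[OF z] assms(1) uvw(3) \<open>w \<noteq> 0\<close> by simp
qed

lemma Residue_theorem_compact_convex:
  assumes T: "compact T" "convex T" and ana: "f analytic_on T - pts"
    and pts: "finite pts" "pts \<subseteq> interior T"
    and g: "valid_path g" "pathfinish g = pathstart g" "path_image g \<subseteq> T - pts"
  shows "contour_integral g f = 2 * pi * \<i> * (\<Sum>p\<in>pts. winding_number g p * residue f p)"
proof -
  obtain V where V: "open V" "T - pts \<subseteq> V" "f holomorphic_on V"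
    using ana analytic_on_holomorphic by metis
  have "T \<subseteq> V \<union> interior T"
    using V(2) pts(2) by blast
  then obtain S where S: "open S" "convex S" "T \<subseteq> S" "S \<subseteq> V \<union> interior T"
    using convex_open_between[OF T] V(1) by (metis open_Un open_interior)
  show ?thesis
  proof (rule Residue_theorem[OF \<open>open S\<close> convex_connected[OF \<open>convex S\<close>] pts(1) _ g(1,2)])
    show "f holomorphic_on S - pts"
      using V(2) S(4) interior_subset by (intro holomorphic_on_subset[OF V(3)]) blast
    show "path_image g \<subseteq> S - pts"
      using g(3) S(3) by blast
    then show "\<forall>z. z \<notin> S \<longrightarrow> winding_number g z = 0"
      using S(2) g by (intro allI impI winding_number_zero_outside[of _ S])
        (auto intro: valid_path_imp_path)
  qed
qed

lemma Residue_theorem_triangle: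
  assumes ana: "f analytic_on convex hull {a, b, c} - pts" and "finite pts"
    and pts: "pts \<subseteq> interior (convex hull {a, b, c})"
    and orient: "0 < Im ((b - a) * cnj (b - c))"
  shows "contour_integral (linepath a b) f + contour_integral (linepath b c) f +
    contour_integral (linepath c a) f = 2 * pi * \<i> * (\<Sum>p\<in>pts. residue f p)"
proof -
  let ?T = "convex hull {a, b, c}" and ?g = "linepath a b +++ linepath b c +++ linepath c a"
  have "compact ?T" by (simp add: finite_imp_compact_convex_hull)
  have "path_image ?g = frontier ?T"
    by (simp add: frontier_of_triangle path_image_join Un_assoc)
  also have "\<dots> \<subseteq> ?T - pts"
    using pts compact_imp_closed[OF \<open>compact ?T\<close>]
    by (metis Diff_mono closure_closed frontier_def order_refl)
  finally have sides: "path_image ?g \<subseteq> ?T - pts" .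
  then have "contour_integral ?g f = 2 * pi * \<i> * (\<Sum>p\<in>pts. winding_number ?g p * residue f p)"
    using assms \<open>compact ?T\<close> by (intro Residue_theorem_compact_convex[of ?T]) auto
  moreover have "winding_number ?g p = 1" if "p \<in> pts" for p
    using winding_number_triangle_ccw[OF orient] pts that by blast
  moreover have "continuous_on (path_image ?g) f"
    using analytic_on_subset[OF ana sides]
    by (intro holomorphic_on_imp_continuous_on analytic_imp_holomorphic)
  then have "f contour_integrable_on linepath a b" "f contour_integrable_on linepath b c"
      "f contour_integrable_on linepath c a"
    by (auto intro!: contour_integrable_continuous_linepath elim!: continuous_on_subset
        simp: path_image_join)
  ultimately show ?thesis
    by (simp add: add.assoc)
qed

lemma of_real_mem_interior_triangle:
  assumes "0 < p" "p < x" "0 < y"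
  shows "of_real p \<in> interior (convex hull {0, Complex x (- y), Complex x y})"
proof -
  let ?b = "Complex x (- y)" and ?c = "Complex x y"
  have ncol: "\<not> collinear {0, ?b, ?c}"
    unfolding collinear_lemma using assms by (auto simp: complex_eq_iff)
  have "(1 - p / x) *\<^sub>R 0 + (p / (2 * x)) *\<^sub>R ?b + (p / (2 * x)) *\<^sub>R ?c = of_real p"
    using assms by (simp add: complex_eq_iff)
  moreover have "(1 - p / x) + p / (2 * x) + p / (2 * x) = 1" "0 < 1 - p / x" "0 < p / (2 * x)"
    using assms by auto
  ultimately show ?thesis
    unfolding interior_convex_hull_3_minimal[OF ncol DIM_complex] mem_Collect_eq by blast
qed

lemma remove_sings_analytic_at_bounded:
  assumes "f meromorphic_on {z}" and bound: "\<forall>\<^sub>F w in at z. norm (f w) \<le> B"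
  shows "remove_sings f analytic_on {z}"
proof -
  have "\<not> is_pole f z"
  proof
    assume "is_pole f z"
    then have "\<forall>\<^sub>F w in at z. B + 1 \<le> norm (f w)"
      unfolding is_pole_def filterlim_at_infinity_conv_norm_at_top by (simp add: filterlim_at_top)
    with bound have "\<forall>\<^sub>F w in at z. False"
      by eventually_elim simp
    then show False by simp
  qed
  then obtain c where "f \<midarrow>z\<rightarrow> c"
    using meromorphic_on_not_essential[OF assms(1)] by (auto simp: not_essential_def)
  then show ?thesis
    using meromorphic_on_isolated_singularity[OF assms(1)]
    by (intro remove_sings_analytic_at[of _ _ c]) auto
qed

lemma residue_divide_simple_zero:
  assumes f: "f analytic_on {z}" and g: "g analytic_on {z}" "g z = 0"
    and g': "(g has_field_derivative g') (at z)" "g' \<noteq> 0"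
  shows "residue (\<lambda>w. f w / g w) z = f z / g'"
proof -
  have "(\<lambda>w. f w / g w) meromorphic_on {z}"
    by (intro meromorphic_intros analytic_on_imp_meromorphic_on f g)
  then have "isolated_singularity_at (\<lambda>w. f w / g w) z"
    by (intro meromorphic_on_isolated_singularity) auto
  then obtain r where r: "0 < r" "(\<lambda>w. f w / g w) analytic_on ball z r - {z}"
    by (auto simp: isolated_singularity_at_def)
  have "((\<lambda>w. f w * ((w - z) / g w)) \<longlongrightarrow> f z * (1 / g')) (at z)"
  proof (intro tendsto_mult)
    show "f \<midarrow>z\<rightarrow> f z"
      using analytic_at_imp_isCont[OF f] by (rule isContD)
    show "((\<lambda>w. (w - z) / g w) \<longlongrightarrow> 1 / g') (at z)"
      by (rule lhopital_complex_simple[where f' = 1])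
        (use g g' in \<open>auto intro!: derivative_eq_intros\<close>)
  qed
  then have "((\<lambda>w. f w / g w * (w - z)) \<longlongrightarrow> f z / g') (at z)"
    by simp
  then show ?thesis
    using r by (intro residue_simple'[of "ball z r"]) (auto intro: analytic_imp_holomorphic)
qed

section \<open>The cotangent kernel\<close>

definition cot_kernel :: "complex \<Rightarrow> complex" where
  "cot_kernel = remove_sings (\<lambda>t. (cot (t / 2) - 2 / t) / t)"

lemma cot_kernel_eq:
  assumes "sin (t / 2) \<noteq> 0"
  shows "cot_kernel t = (cot (t / 2) - 2 / t) / t"
proof -
  have "t \<noteq> 0" using assms by auto
  then have "(\<lambda>t. (cot (t / 2) - 2 / t) / t) analytic_on {t}"
    unfolding cot_def using assms by (intro analytic_intros) auto
  then show ?thesis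
    by (simp add: cot_kernel_def)
qed

lemma norm_mult_cos_minus_sin_le:
  fixes z :: complex
  assumes "norm z \<le> 1"
  shows "norm (z * cos z - sin z) \<le> 6 * norm z ^ 3"
proof -
  have exp_le: "exp \<bar>Im z\<bar> \<le> 3"
  proof -
    have "exp \<bar>Im z\<bar> \<le> exp 1"
      using abs_Im_le_cmod[of z] assms by simp
    also have "\<dots> \<le> 3" by (rule exp_le)
    finally show ?thesis .
  qed
  have "norm (cos z - 1) \<le> exp \<bar>Im z\<bar> * norm z ^ 2"
    using Taylor_cos[of z 1] by (simp add: cos_coeff_def numeral_2_eq_2)
  also have "\<dots> \<le> 3 * norm z ^ 2"
    using exp_le by (intro mult_right_mono) auto
  finally have "norm (z * (cos z - 1)) \<le> norm z * (3 * norm z ^ 2)"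
    by (simp only: norm_mult) (intro mult_left_mono, auto)
  moreover have "norm (sin z - z) \<le> 3 * norm z ^ 3"
  proof -
    have "norm (sin z - z) \<le> exp \<bar>Im z\<bar> * norm z ^ 3 / 2"
      using Taylor_sin[of z 2] by (simp add: sin_coeff_def numeral_2_eq_2 numeral_3_eq_3)
    also have "\<dots> \<le> exp \<bar>Im z\<bar> * norm z ^ 3" by simp
    also have "\<dots> \<le> 3 * norm z ^ 3"
      using exp_le by (intro mult_right_mono) auto
    finally show ?thesis .
  qed
  ultimately have "norm (z * (cos z - 1) - (sin z - z)) \<le>
      norm z * (3 * norm z ^ 2) + 3 * norm z ^ 3"
    using norm_triangle_ineq4 by (meson add_mono order_trans)
  then show ?thesis
    by (simp add: algebra_simps power2_eq_square power3_eq_cube)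
qed

lemma cot_kernel_analytic_at_0: "cot_kernel analytic_on {0}"
  unfolding cot_kernel_def
proof (rule remove_sings_analytic_at_bounded)
  show "(\<lambda>t. (cot (t / 2) - 2 / t) / t) meromorphic_on {0}"
    unfolding cot_def
    by (intro meromorphic_intros analytic_on_imp_meromorphic_on[of "\<lambda>t. sin (t / 2)"]
        analytic_on_imp_meromorphic_on[of "\<lambda>t. cos (t / 2)"] analytic_intros) auto
  have "((\<lambda>t::complex. t / sin (t / 2)) \<longlongrightarrow> 2) (at 0)"
    by (rule lhopital_complex_simple[where f' = 1 and g' = "1 / 2"])
      (auto intro!: derivative_eq_intros)
  from order_tendstoD(2)[OF tendsto_norm[OF this], of 3] tendsto_imp_eventually_ne[OF this, of 0]
  have "\<forall>\<^sub>F t::complex in at 0. norm (t / sin (t / 2)) < 3"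
    and "\<forall>\<^sub>F t::complex in at 0. t / sin (t / 2) \<noteq> 0"
    by auto
  moreover have "\<forall>\<^sub>F t::complex in at 0. t \<in> ball 0 1 - {0}"
    by (intro eventually_at_in_open) auto
  ultimately show "\<forall>\<^sub>F t::complex in at 0. norm ((cot (t / 2) - 2 / t) / t) \<le> 2 * (6 / 8) * 3"
  proof eventually_elim
    case (elim t)
    let ?z = "t / 2"
    have "sin ?z \<noteq> 0" "t \<noteq> 0" using elim by auto
    then have eq: "(cot ?z - 2 / t) / t = 2 * ((?z * cos ?z - sin ?z) / t ^ 3) * (t / sin ?z)"
      by (simp add: cot_def divide_simps power3_eq_cube)
    have "norm (?z * cos ?z - sin ?z) \<le> 6 * norm ?z ^ 3"
      using elim by (intro norm_mult_cos_minus_sin_le) (auto simp: norm_divide)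
    then have "norm ((?z * cos ?z - sin ?z) / t ^ 3) \<le> 6 / 8"
      using \<open>t \<noteq> 0\<close> by (simp add: norm_divide norm_power power_divide divide_simps)
    then show ?case
      unfolding eq norm_mult using elim by (intro mult_mono) auto
  qed
qed

lemma cot_kernel_analytic_on:
  assumes "\<And>t. t \<in> A \<Longrightarrow> sin (t / 2) = 0 \<Longrightarrow> t = 0"
  shows "cot_kernel analytic_on A"
  unfolding analytic_on_analytic_at[of _ A]
proof
  fix t assume "t \<in> A"
  show "cot_kernel analytic_on {t}"
  proof (cases "t = 0")
    case False
    with assms \<open>t \<in> A\<close> show ?thesis
      unfolding cot_kernel_def cot_def
      by (intro remove_sings_analytic_on analytic_intros) auto
  qed (simp add: cot_kernel_analytic_at_0)
qed

lemma norm_cot_kernel_le: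
  assumes "sin (t / 2) \<noteq> 0" and "1 \<le> norm t"
  shows "norm (cot_kernel t) \<le> norm (cot (t / 2)) + 2"
proof -
  have "norm (cot_kernel t) \<le> norm (cot (t / 2) - 2 / t)"
    using assms by (auto simp: cot_kernel_eq norm_divide divide_le_eq mult_le_cancel_left1)
  also have "\<dots> \<le> norm (cot (t / 2)) + norm (2 / t)"
    by (rule norm_triangle_ineq4)
  also have "norm (2 / t) \<le> 2"
    using assms by (simp add: norm_divide divide_le_eq)
  finally show ?thesis by simp
qed

lemma residue_mult_cot_kernel:
  assumes u: "u analytic_on {p}" and p: "sin (p / 2) = 0" "p \<noteq> 0"
  shows "residue (\<lambda>t. u t * cot_kernel t) p = 2 * u p / p"
proof -
  let ?f = "\<lambda>t. u t * (cos (t / 2) - 2 * sin (t / 2) / t) / t"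
  have "cos (p / 2) \<noteq> 0"
    using p(1) sin_cos_squared_add[of "p / 2"] by auto
  have "((\<lambda>t. sin (t / 2)) has_field_derivative cos (p / 2) / 2) (at p)"
    by (auto intro!: derivative_eq_intros)
  from tendsto_imp_eventually_ne[OF has_field_derivativeD[OF this], of 0]
  have "\<forall>\<^sub>F t in at p. sin (t / 2) / (t - p) \<noteq> 0"
    using p(1) \<open>cos (p / 2) \<noteq> 0\<close> by simp
  then have "\<forall>\<^sub>F t in at p. sin (t / 2) \<noteq> 0"
    by eventually_elim auto
  then have "\<forall>\<^sub>F t in at p. u t * cot_kernel t = ?f t / sin (t / 2)"
    by eventually_elim (auto simp: cot_kernel_eq cot_def field_simps)
  then have "residue (\<lambda>t. u t * cot_kernel t) p = residue (\<lambda>t. ?f t / sin (t / 2)) p"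
    by (intro residue_cong) auto
  also have "\<dots> = ?f p / (cos (p / 2) / 2)"
    using u p \<open>cos (p / 2) \<noteq> 0\<close>
    by (intro residue_divide_simple_zero) (auto intro!: analytic_intros derivative_eq_intros)
  also have "\<dots> = 2 * u p / p"
    using p \<open>cos (p / 2) \<noteq> 0\<close> by simp
  finally show ?thesis .
qed

section \<open>Ray integrals over the boundary of a sector\<close>

text \<open>For \<open>0 < d < \<pi> / 2\<close> this is the closed sector \<open>\<bar>arg t\<bar> \<le> d\<close> together with its vertex 0.\<close>

definition sector :: "real \<Rightarrow> complex set" where
  "sector d = {t. \<bar>Im t\<bar> \<le> tan d * Re t}"

lemma convex_sector: "convex (sector d)"
proof -
  have "sector d = {t. Complex (- tan d) 1 \<bullet> t \<le> 0} \<inter> {t. Complex (- tan d) (- 1) \<bullet> t \<le> 0}"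
    by (auto simp: sector_def inner_complex_def abs_le_iff algebra_simps)
  then show ?thesis
    by (simp add: convex_Int convex_halfspace_le)
qed

lemma Re_nonneg_sector:
  assumes "0 < d" "d < pi / 2" "t \<in> sector d"
  shows "0 \<le> Re t"
proof -
  have "0 \<le> tan d * Re t"
    using assms(3) by (simp add: sector_def order_trans[OF abs_ge_zero])
  then show ?thesis
    using tan_gt_zero[OF assms(1,2)] by (simp add: zero_le_mult_iff)
qed

lemma Im_mult_sector_le:
  assumes "t \<in> sector d" "0 \<le> Re t"
  shows "Im (a * t) \<le> (Im a + \<bar>Re a\<bar> * tan d) * Re t"
proof -
  have "Re a * Im t \<le> \<bar>Re a\<bar> * \<bar>Im t\<bar>"
    using abs_ge_self[of "Re a * Im t"] by (simp add: abs_mult)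
  also have "\<dots> \<le> \<bar>Re a\<bar> * (tan d * Re t)"
    using assms(1) by (intro mult_left_mono) (auto simp: sector_def)
  finally show ?thesis by (simp add: algebra_simps)
qed

lemma abs_Im_mult_sector_le:
  assumes "t \<in> sector d" "0 \<le> Re t"
  shows "\<bar>Im (a * t)\<bar> \<le> (\<bar>Im a\<bar> + \<bar>Re a\<bar> * tan d) * Re t"
proof -
  have "(Im z + c) * Re t \<le> (\<bar>Im z\<bar> + c) * Re t" for z :: complex and c
    using assms(2) by (intro mult_right_mono) auto
  then have "Im (z * t) \<le> (\<bar>Im z\<bar> + \<bar>Re z\<bar> * tan d) * Re t" for z
    using Im_mult_sector_le[OF assms] order_trans by blast
  from this[of a] this[of "- a"] show ?thesis by simp
qed

lemma ray_mem_sector: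
  assumes "\<bar>\<phi>\<bar> \<le> d" "d < pi / 2" "0 \<le> r"
  shows "of_real r * cis \<phi> \<in> sector d"
proof -
  have cos: "0 < cos \<phi>"
    using assms by (intro cos_gt_zero_pi) auto
  have "\<bar>sin \<phi>\<bar> = tan \<bar>\<phi>\<bar> * cos \<phi>"
  proof -
    have "0 \<le> sin \<bar>\<phi>\<bar>" using assms by (intro sin_ge_zero) auto
    moreover have "\<bar>sin \<bar>\<phi>\<bar>\<bar> = \<bar>sin \<phi>\<bar>" by (auto simp: abs_if)
    ultimately show ?thesis using cos by (simp add: tan_def)
  qed
  also have "\<dots> \<le> tan d * cos \<phi>"
    using assms cos by (intro mult_right_mono) (auto simp: tan_mono_le_eq)
  finally have "r * \<bar>sin \<phi>\<bar> \<le> r * (tan d * cos \<phi>)"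
    using assms(3) by (rule mult_left_mono)
  then show ?thesis
    using assms(3) by (simp add: sector_def abs_mult mult_ac)
qed

definition cot_half_pole :: "nat \<Rightarrow> complex" where
  "cot_half_pole n = of_real (2 * pi * real (Suc n))"

definition cot_half_zero :: "nat \<Rightarrow> real" where
  "cot_half_zero N = (2 * real N + 1) * pi"

lemma cot_half_zero_gt_1: "1 < cot_half_zero N"
proof -
  have "1 * pi \<le> cot_half_zero N"
    unfolding cot_half_zero_def by (intro mult_right_mono) auto
  then show ?thesis using pi_gt3 by simp
qed

lemma cos_half_cot_half_zero: "cos (cot_half_zero N / 2) = 0"
  unfolding cos_zero_iff_int by (intro exI[of _ "2 * int N + 1"]) (simp add: cot_half_zero_def)

lemma cot_half_pole_nonzero: "cot_half_pole n \<noteq> 0"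
  by (simp add: cot_half_pole_def del: of_nat_Suc)

lemma sin_half_cot_half_pole: "sin (cot_half_pole n / 2) = 0"
  unfolding sin_half_eq_0_iff cot_half_pole_def by (intro exI[of _ "int (Suc n)"]) simp

lemma inj_cot_half_pole: "inj cot_half_pole"
  by (auto simp: inj_def cot_half_pole_def)

lemma sin_half_zero_below_cot_half_zero:
  assumes "sin (t / 2) = 0" "t \<noteq> 0" "0 \<le> Re t" "Re t \<le> cot_half_zero N"
  shows "t \<in> cot_half_pole ` {..<N}"
proof -
  obtain m :: int where m: "t = of_real (2 * pi * m)"
    using assms(1) sin_half_eq_0_iff by blast
  have "0 \<le> m" "m \<noteq> 0"
    using assms(2,3) pi_gt_zero by (auto simp: m zero_le_mult_iff simp del: pi_gt_zero)
  have "pi * (2 * of_int m) \<le> pi * (2 * real N + 1)"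
    using assms(4) by (simp add: m cot_half_zero_def mult_ac)
  then have "m \<le> int N" by simp
  then show ?thesis
    using \<open>0 \<le> m\<close> \<open>m \<noteq> 0\<close>
    by (intro image_eqI[of _ _ "nat (m - 1)"]) (auto simp: m cot_half_pole_def)
qed

lemma cot_half_pole_less_cot_half_zero: "n < N \<Longrightarrow> 2 * pi * real (Suc n) < cot_half_zero N"
  by (simp add: cot_half_zero_def mult.commute[of _ pi])

locale sector_decay =
  fixes u :: "complex \<Rightarrow> complex" and d \<delta> C :: real
  assumes angle: "0 < d" "d < pi / 2" and rate: "0 < \<delta>"
    and analytic: "u analytic_on sector d"
    and decay: "\<And>t. t \<in> sector d \<Longrightarrow> 1 \<le> Re t \<Longrightarrow> norm (u t) \<le> C * exp (- \<delta> * Re t)"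
begin

definition integrand :: "complex \<Rightarrow> complex" where
  "integrand t = u t * cot_kernel t"

lemma trig_pos: "0 < cos d" "0 < sin d" "0 < tan d"
  using angle by (auto intro: cos_gt_zero sin_gt_zero tan_gt_zero)

lemma integrand_analytic_on:
  assumes "A \<subseteq> sector d" "\<And>t. t \<in> A \<Longrightarrow> sin (t / 2) = 0 \<Longrightarrow> t = 0"
  shows "integrand analytic_on A"
  unfolding integrand_def using assms
  by (intro analytic_on_mult analytic_on_subset[OF analytic] cot_kernel_analytic_on)

lemma norm_integrand_le:
  assumes "t \<in> sector d" "1 \<le> Re t" "sin (t / 2) \<noteq> 0" "norm (cot (t / 2)) \<le> B"
  shows "norm (integrand t) \<le> C * (B + 2) * exp (- \<delta> * Re t)"
proof -
  have "1 \<le> norm t"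
    using assms(2) complex_Re_le_cmod order_trans by blast
  then have "norm (cot_kernel t) \<le> B + 2"
    using norm_cot_kernel_le[of t] assms(3,4) by simp
  then have "norm (integrand t) \<le> C * exp (- \<delta> * Re t) * (B + 2)"
    unfolding integrand_def norm_mult using decay[OF assms(1,2)]
    by (intro mult_mono) (auto intro: order_trans[OF norm_ge_zero])
  then show ?thesis by (simp add: mult_ac)
qed

lemma ray_Re_Im:
  assumes "\<phi> = d \<or> \<phi> = - d" "0 \<le> r"
  shows "Re (of_real r * cis \<phi>) = r * cos d" "\<bar>Im (of_real r * cis \<phi>)\<bar> = r * cos d * tan d"
  using assms trig_pos by (auto simp: tan_def abs_mult)

lemma ray_avoids_poles:
  assumes "\<phi> = d \<or> \<phi> = - d" "sin (of_real r * cis \<phi> / 2) = 0"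
  shows "r = 0"
proof -
  have "Im (of_real r * cis \<phi>) = 0"
    using assms(2) by (metis sin_half_eq_0_iff Im_complex_of_real)
  then show ?thesis
    using assms(1) trig_pos by auto
qed

lemma norm_integrand_ray_le:
  assumes \<phi>: "\<phi> = d \<or> \<phi> = - d" and "1 / cos d \<le> r"
  defines "t \<equiv> of_real r * cis \<phi>"
  shows "norm (integrand t) \<le> C * (3 + 2 / tan d) * exp (- (\<delta> * cos d) * r)"
proof -
  have r: "0 \<le> r" "1 \<le> r * cos d"
    using assms(2) trig_pos order_trans[of 0 "1 / cos d" r] by (auto simp: field_simps)
  note Re_Im = ray_Re_Im[OF \<phi> r(1), folded t_def]
  have "1 * tan d \<le> \<bar>Im t\<bar>"
    unfolding Re_Im using r trig_pos by (intro mult_right_mono) auto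
  then have Im: "tan d / 2 \<le> \<bar>Im (t / 2)\<bar>" by simp
  then have "norm (cot (t / 2)) \<le> 1 + 1 / \<bar>Im (t / 2)\<bar>"
    using trig_pos by (intro norm_cot_le) auto
  also have "\<dots> \<le> 1 + 1 / (tan d / 2)"
    using Im trig_pos by (intro add_left_mono frac_le) auto
  finally have "norm (cot (t / 2)) \<le> 1 + 2 / tan d" by simp
  moreover have "t \<in> sector d"
    using \<phi> angle r unfolding t_def by (intro ray_mem_sector) auto
  moreover have "sin (t / 2) \<noteq> 0"
    using ray_avoids_poles[OF \<phi>, of r] r by (auto simp: t_def)
  ultimately have "norm (integrand t) \<le> C * (1 + 2 / tan d + 2) * exp (- \<delta> * Re t)"
    using r Re_Im by (intro norm_integrand_le) auto
  then show ?thesis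
    unfolding Re_Im by (simp add: mult_ac)
qed

lemma contour_integral_integrand_tendsto:
  assumes \<phi>: "\<phi> = d \<or> \<phi> = - d"
  shows "((\<lambda>R. contour_integral (linepath 0 (of_real R * cis \<phi>)) integrand) \<longlongrightarrow>
    ray_integral \<phi> integrand) at_top"
proof (rule contour_integral_linepath_tendsto_ray_integral)
  let ?ray = "\<lambda>r. of_real r * cis \<phi>"
  have "integrand analytic_on ?ray ` {0..}"
    using \<phi> angle ray_avoids_poles[OF \<phi>]
    by (intro integrand_analytic_on) (auto intro!: ray_mem_sector)
  then have "continuous_on (?ray ` {0..}) integrand"
    by (intro holomorphic_on_imp_continuous_on analytic_imp_holomorphic)
  then show "continuous_on {0..} (\<lambda>r. integrand (?ray r))"
    by (rule continuous_on_compose2) (auto intro!: continuous_intros)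
  show "0 < \<delta> * cos d"
    using rate trig_pos by simp
qed (rule norm_integrand_ray_le[OF \<phi>])

definition corner :: "real \<Rightarrow> complex" where
  "corner x = Complex x (x * tan d)"

lemma corner_polar:
  "corner x = of_real (x / cos d) * cis d"
  "cnj (corner x) = of_real (x / cos d) * cis (- d)"
  using trig_pos by (simp_all add: corner_def complex_eq_iff tan_def)

lemma corner_mem_sector:
  assumes "0 \<le> x"
  shows "corner x \<in> sector d" "cnj (corner x) \<in> sector d"
  using assms trig_pos by (auto simp: corner_def sector_def)

lemma triangle_subset_sector:
  assumes "0 \<le> x"
  shows "convex hull {0, cnj (corner x), corner x} \<subseteq> sector d \<inter> {t. Re t \<le> x}"
  using corner_mem_sector[OF assms] assms
  by (intro hull_minimal convex_Int convex_sector convex_halfspace_Re_le)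
    (auto simp: corner_def sector_def)

lemma side_subset_sector:
  assumes "0 \<le> x"
  shows "closed_segment (cnj (corner x)) (corner x) \<subseteq> sector d \<inter> {t. Re t = x}"
proof -
  have "closed_segment (cnj (corner x)) (corner x) \<subseteq> sector d \<inter> {t. Re t \<le> x} \<inter> {t. x \<le> Re t}"
    using corner_mem_sector[OF assms]
    by (intro closed_segment_subset convex_Int convex_sector convex_halfspace_Re_le
        convex_halfspace_Re_ge) (auto simp: corner_def)
  then show ?thesis by fastforce
qed

lemma cot_half_pole_mem_sector: "cot_half_pole n \<in> sector d"
  using trig_pos by (simp add: cot_half_pole_def sector_def)

lemma residue_integrand:
  "residue integrand (cot_half_pole n) = 2 * u (cot_half_pole n) / cot_half_pole n"
  unfolding integrand_def[abs_def] using cot_half_pole_mem_sector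
  by (intro residue_mult_cot_kernel sin_half_cot_half_pole cot_half_pole_nonzero)
    (auto intro: analytic_on_subset[OF analytic])

lemma cot_half_pole_mem_interior_triangle:
  assumes "n < N"
  defines "v \<equiv> corner (cot_half_zero N)"
  shows "cot_half_pole n \<in> interior (convex hull {0, cnj v, v})"
proof -
  let ?x = "cot_half_zero N"
  have "v = Complex ?x (?x * tan d)" "cnj v = Complex ?x (- (?x * tan d))"
    by (simp_all add: v_def corner_def complex_eq_iff)
  moreover have "0 < ?x * tan d"
    using cot_half_zero_gt_1[of N] trig_pos by simp
  ultimately show ?thesis
    unfolding cot_half_pole_def using cot_half_pole_less_cot_half_zero[OF assms(1)]
    by (simp only:) (intro of_real_mem_interior_triangle; simp)
qed

lemma integrand_analytic_on_triangle:
  fixes N :: nat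
  defines "v \<equiv> corner (cot_half_zero N)"
  shows "integrand analytic_on convex hull {0, cnj v, v} - cot_half_pole ` {..<N}"
proof -
  have triangle: "convex hull {0, cnj v, v} \<subseteq> sector d \<inter> {t. Re t \<le> cot_half_zero N}"
    unfolding v_def using cot_half_zero_gt_1[of N] by (intro triangle_subset_sector) simp
  then have "t = 0"
    if "t \<in> convex hull {0, cnj v, v} - cot_half_pole ` {..<N}" "sin (t / 2) = 0" for t
    using that Re_nonneg_sector[OF angle] sin_half_zero_below_cot_half_zero[of t N] by blast
  with triangle show ?thesis
    by (intro integrand_analytic_on) auto
qed

lemma triangle_residue_sum:
  fixes N :: nat
  defines "v \<equiv> corner (cot_half_zero N)"
  shows "contour_integral (linepath 0 (cnj v)) integrand +
    contour_integral (linepath (cnj v) v) integrand - contour_integral (linepath 0 v) integrand =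
    (\<Sum>n<N. 2 * \<i> * (u (cot_half_pole n) / of_nat (Suc n)))"
proof -
  have "0 < Im ((cnj v - 0) * cnj (cnj v - v))"
    using cot_half_zero_gt_1[of N] trig_pos by (simp add: v_def corner_def)
  then have "contour_integral (linepath 0 (cnj v)) integrand +
      contour_integral (linepath (cnj v) v) integrand + contour_integral (linepath v 0) integrand =
      2 * pi * \<i> * (\<Sum>p\<in>cot_half_pole ` {..<N}. residue integrand p)"
    unfolding v_def using integrand_analytic_on_triangle cot_half_pole_mem_interior_triangle
    by (intro Residue_theorem_triangle) auto
  also have "contour_integral (linepath v 0) integrand =
      - contour_integral (linepath 0 v) integrand"
    using contour_integral_reversepath[of "linepath 0 v" integrand] by simp
  also have "(\<Sum>p\<in>cot_half_pole ` {..<N}. residue integrand p) =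
      (\<Sum>n<N. 2 * u (cot_half_pole n) / cot_half_pole n)"
    by (subst sum.reindex) (auto simp: residue_integrand intro: inj_on_subset[OF inj_cot_half_pole])
  also have "2 * pi * \<i> * \<dots> = (\<Sum>n<N. 2 * \<i> * (u (cot_half_pole n) / of_nat (Suc n)))"
    unfolding sum_distrib_left
    by (intro sum.cong refl) (simp add: cot_half_pole_def divide_simps del: of_nat_Suc)
  finally show ?thesis
    by (simp only: diff_conv_add_uminus)
qed

lemma norm_contour_integral_side_le:
  fixes N :: nat
  defines "x \<equiv> cot_half_zero N"
  shows "norm (contour_integral (linepath (cnj (corner x)) (corner x)) integrand) \<le>
    C * 3 * exp (- \<delta> * x) * (2 * x * tan d)"
proof -
  have "1 < x" using cot_half_zero_gt_1 by (simp add: x_def)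
  let ?side = "closed_segment (cnj (corner x)) (corner x)"
  have side: "t \<in> sector d" "Re t = x" "sin (t / 2) \<noteq> 0" "norm (cot (t / 2)) \<le> 1"
    if "t \<in> ?side" for t
  proof -
    show "t \<in> sector d" "Re t = x"
      using side_subset_sector[of x] \<open>1 < x\<close> that by auto
    then show "sin (t / 2) \<noteq> 0" "norm (cot (t / 2)) \<le> 1"
      using cos_half_cot_half_zero[of N]
      by (auto simp: x_def intro!: sin_neq_0_if_cos_Re_eq_0 norm_cot_le_1)
  qed
  have bound: "norm (integrand t) \<le> C * 3 * exp (- \<delta> * x)" if "t \<in> ?side" for t
    using norm_integrand_le[of t 1] side[OF that] \<open>1 < x\<close> by simp
  have "integrand analytic_on ?side"
    using side by (intro integrand_analytic_on) auto
  then have "integrand contour_integrable_on linepath (cnj (corner x)) (corner x)"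
    by (intro contour_integrable_continuous_linepath holomorphic_on_imp_continuous_on
        analytic_imp_holomorphic)
  then have "norm (contour_integral (linepath (cnj (corner x)) (corner x)) integrand)
      \<le> C * 3 * exp (- \<delta> * x) * norm (corner x - cnj (corner x))"
    using bound order_trans[OF norm_ge_zero bound] by (intro contour_integral_bound_linepath) auto
  also have "corner x - cnj (corner x) = \<i> * of_real (2 * x * tan d)"
    by (simp add: corner_def complex_eq_iff)
  also have "norm \<dots> = 2 * x * tan d"
    using \<open>1 < x\<close> trig_pos by (simp add: norm_mult)
  finally show ?thesis .
qed

theorem ray_integral_difference_sums:
  "(\<lambda>n. 2 * \<i> * (u (cot_half_pole n) / of_nat (Suc n))) sums
    (ray_integral (- d) integrand - ray_integral d integrand)"
proof -
  define v where "v N = corner (cot_half_zero N)" for N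
  define I where "I z = contour_integral (linepath 0 z) integrand" for z
  define side where "side N = contour_integral (linepath (cnj (v N)) (v N)) integrand" for N
  have "filterlim (\<lambda>N. cot_half_zero N / cos d) at_top sequentially"
    unfolding cot_half_zero_def using trig_pos by real_asymp
  then have ray: "(\<lambda>N. I (of_real (cot_half_zero N / cos d) * cis \<phi>)) \<longlonglongrightarrow> ray_integral \<phi> integrand"
    if "\<phi> = d \<or> \<phi> = - d" for \<phi>
    unfolding I_def using filterlim_compose[OF contour_integral_integrand_tendsto[OF that]] by blast
  have "(\<lambda>N. I (v N)) \<longlonglongrightarrow> ray_integral d integrand"
    unfolding v_def corner_polar(1) by (rule ray) simp
  moreover have "(\<lambda>N. I (cnj (v N))) \<longlonglongrightarrow> ray_integral (- d) integrand"
    unfolding v_def corner_polar(2) by (rule ray) simp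
  moreover have "side \<longlonglongrightarrow> 0"
  proof (rule Lim_null_comparison)
    show "\<forall>\<^sub>F N in sequentially. norm (side N) \<le>
        C * 3 * exp (- \<delta> * cot_half_zero N) * (2 * cot_half_zero N * tan d)"
      unfolding side_def v_def by (intro always_eventually allI norm_contour_integral_side_le)
    show "(\<lambda>N. C * 3 * exp (- \<delta> * cot_half_zero N) * (2 * cot_half_zero N * tan d)) \<longlonglongrightarrow> 0"
      unfolding cot_half_zero_def using rate by real_asymp
  qed
  ultimately have "(\<lambda>N. I (cnj (v N)) + side N - I (v N)) \<longlonglongrightarrow>
      ray_integral (- d) integrand + 0 - ray_integral d integrand"
    by (intro tendsto_intros)
  moreover have "I (cnj (v N)) + side N - I (v N) =
      (\<Sum>n<N. 2 * \<i> * (u (cot_half_pole n) / of_nat (Suc n)))" for N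
    unfolding I_def side_def v_def by (rule triangle_residue_sum)
  ultimately show ?thesis by (simp add: sums_def)
qed

end

section \<open>Exponential decay in a strip\<close>

lemma exp_i_neq_1_if_Im_neg:
  fixes z :: complex
  assumes "Im z < 0"
  shows "exp (\<i> * z) \<noteq> 1"
proof
  assume "exp (\<i> * z) = 1"
  then have "norm (exp (\<i> * z)) = 1" by simp
  with assms show False by simp
qed

lemma norm_sin_divide_exp_minus_1_le:
  fixes w z :: complex
  assumes "\<bar>Im w\<bar> + c \<le> - Im z" "0 < b" "b \<le> c"
  shows "norm (sin w / (exp (\<i> * z) - 1)) \<le> 1 / (1 - exp (- b)) * exp (- c)"
proof -
  have "0 < 1 - exp (- b)" using assms by simp
  have "exp (\<bar>Im w\<bar> + c) * (1 - exp (- b)) \<le> exp (- Im z) * (1 - exp (Im z))"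
    using assms by (intro mult_mono) auto
  also have "\<dots> = norm (exp (\<i> * z)) - norm (1::complex)"
    by (simp add: algebra_simps flip: exp_add)
  also have "\<dots> \<le> norm (exp (\<i> * z) - 1)"
    by (rule norm_triangle_ineq2)
  finally have "norm (sin w / (exp (\<i> * z) - 1)) \<le>
      exp \<bar>Im w\<bar> / (exp (\<bar>Im w\<bar> + c) * (1 - exp (- b)))"
    unfolding norm_divide using \<open>0 < 1 - exp (- b)\<close>
    by (intro frac_le norm_sin_le_exp_Im) auto
  also have "\<dots> = exp (\<bar>Im w\<bar> - (\<bar>Im w\<bar> + c)) / (1 - exp (- b))"
    by (simp only: exp_diff divide_divide_eq_left)
  finally show ?thesis by simp
qed

definition sin_expm1_quotient :: "complex \<Rightarrow> complex \<Rightarrow> complex \<Rightarrow> complex" where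
  "sin_expm1_quotient \<tau> \<xi> = remove_sings (\<lambda>t. sin (\<xi> / \<tau> * t) / (exp (\<i> * t / \<tau>) - 1))"

lemma sin_expm1_quotient_analytic_at:
  assumes "\<tau> \<noteq> 0" "exp (\<i> * t / \<tau>) \<noteq> 1"
  shows "sin_expm1_quotient \<tau> \<xi> analytic_on {t}"
    and "sin_expm1_quotient \<tau> \<xi> t = sin (\<xi> / \<tau> * t) / (exp (\<i> * t / \<tau>) - 1)"
proof -
  have "(\<lambda>t. sin (\<xi> / \<tau> * t) / (exp (\<i> * t / \<tau>) - 1)) analytic_on {t}"
    using assms by (intro analytic_intros) auto
  then show "sin_expm1_quotient \<tau> \<xi> analytic_on {t}"
    and "sin_expm1_quotient \<tau> \<xi> t = sin (\<xi> / \<tau> * t) / (exp (\<i> * t / \<tau>) - 1)"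
    unfolding sin_expm1_quotient_def by (simp_all add: remove_sings_analytic_on)
qed

lemma sin_expm1_quotient_analytic_at_0:
  assumes "\<tau> \<noteq> 0"
  shows "sin_expm1_quotient \<tau> \<xi> analytic_on {0}"
  unfolding sin_expm1_quotient_def
proof (rule remove_sings_analytic_at)
  let ?f = "\<lambda>t. sin (\<xi> / \<tau> * t) / (exp (\<i> * t / \<tau>) - 1)"
  have "?f meromorphic_on {0}"
    using assms by (intro meromorphic_on_divide analytic_on_imp_meromorphic_on analytic_intros) auto
  then show "isolated_singularity_at ?f 0"
    by (intro meromorphic_on_isolated_singularity) auto
  show "?f \<midarrow>0\<rightarrow> \<xi> / \<i>"
    by (rule lhopital_complex_simple[where f' = "\<xi> / \<tau>" and g' = "\<i> / \<tau>"])
      (use assms in \<open>auto intro!: derivative_eq_intros simp: field_simps\<close>)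
qed

locale strip_sector =
  fixes \<tau> \<xi> :: complex and d \<delta> :: real
  assumes tau_nonzero: "\<tau> \<noteq> 0" and angle: "0 < d" "d < pi / 2" and rate: "0 < \<delta>"
    and exponent_gap: "\<And>t. t \<in> sector d \<Longrightarrow> \<bar>Im (\<xi> / \<tau> * t)\<bar> + \<delta> * Re t \<le> - Im (t / \<tau>)"
begin

lemma exp_neq_1:
  assumes "t \<in> sector d" "t \<noteq> 0"
  shows "exp (\<i> * t / \<tau>) \<noteq> 1"
proof -
  have "Re t \<noteq> 0"
    using assms by (auto simp: sector_def complex_eq_iff)
  then have "0 < \<delta> * Re t"
    using Re_nonneg_sector[OF angle assms(1)] rate by simp
  then have "Im (t / \<tau>) < 0"
    using exponent_gap[OF assms(1)] by linarith
  then show ?thesis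
    using exp_i_neq_1_if_Im_neg[of "t / \<tau>"] by simp
qed

lemmas sin_expm1_quotient_eq = sin_expm1_quotient_analytic_at(2)[OF tau_nonzero exp_neq_1]

sublocale sector_decay "sin_expm1_quotient \<tau> \<xi>" d \<delta> "1 / (1 - exp (- \<delta>))"
proof
  show "sin_expm1_quotient \<tau> \<xi> analytic_on sector d"
    unfolding analytic_on_analytic_at[of _ "sector d"]
    using sin_expm1_quotient_analytic_at(1) sin_expm1_quotient_analytic_at_0 exp_neq_1 tau_nonzero
    by metis
next
  fix t assume t: "t \<in> sector d" "1 \<le> Re t"
  have "\<delta> * 1 \<le> \<delta> * Re t"
    using rate t(2) by (intro mult_left_mono) auto
  then have "norm (sin (\<xi> / \<tau> * t) / (exp (\<i> * (t / \<tau>)) - 1)) \<le>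
      1 / (1 - exp (- \<delta>)) * exp (- (\<delta> * Re t))"
    using exponent_gap[OF t(1)] rate by (intro norm_sin_divide_exp_minus_1_le) auto
  moreover have "t \<noteq> 0" using t(2) by auto
  ultimately show "norm (sin_expm1_quotient \<tau> \<xi> t) \<le> 1 / (1 - exp (- \<delta>)) * exp (- \<delta> * Re t)"
    using t(1) by (simp add: sin_expm1_quotient_eq)
qed (use angle rate in auto)

lemma P_ray_eq_ray_integral:
  assumes "\<phi> = d \<or> \<phi> = - d"
  shows "P_ray \<phi> \<tau> \<xi> = ray_integral \<phi> integrand"
  unfolding P_ray_def
proof (rule ray_integral_spike_0)
  fix r :: real assume "0 < r"
  let ?t = "of_real r * cis \<phi>"
  have t: "?t \<in> sector d" "?t \<noteq> 0"
    using assms angle \<open>0 < r\<close> by (auto intro!: ray_mem_sector)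
  have off_pole: "sin (?t / 2) \<noteq> 0"
    using ray_avoids_poles[OF assms, of r] \<open>0 < r\<close> by auto
  show "sin (\<xi> / \<tau> * ?t) / (exp (\<i> * ?t / \<tau>) - 1) * (cot (?t / 2) - 2 / ?t) / ?t = integrand ?t"
    by (simp only: integrand_def cot_kernel_eq[OF off_pole] sin_expm1_quotient_eq[OF t]
        times_divide_eq_right)
qed

lemma P_ray_difference_sums:
  "(\<lambda>n. 2 * \<i> * (sin (2 * of_nat (Suc n) * \<xi> * of_real pi / \<tau>) /
      (of_nat (Suc n) * (exp (2 * of_nat (Suc n) * of_real pi * \<i> / \<tau>) - 1)))) sums
    (P_ray (- d) \<tau> \<xi> - P_ray d \<tau> \<xi>)"
proof -
  have "sin_expm1_quotient \<tau> \<xi> (cot_half_pole n) / of_nat (Suc n) =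
      sin (2 * of_nat (Suc n) * \<xi> * of_real pi / \<tau>) /
      (of_nat (Suc n) * (exp (2 * of_nat (Suc n) * of_real pi * \<i> / \<tau>) - 1))" for n
    by (simp add: sin_expm1_quotient_eq cot_half_pole_mem_sector cot_half_pole_nonzero
        del: of_nat_Suc)
      (simp add: cot_half_pole_def mult_ac del: of_nat_Suc)
  then show ?thesis
    using ray_integral_difference_sums by (simp only: P_ray_eq_ray_integral simp_thms)
qed

lemma mem_Omega:
  assumes "\<bar>\<phi>\<bar> \<le> d" "0 < Arg \<tau> - \<phi>" "Arg \<tau> - \<phi> < pi"
  shows "(\<tau>, \<xi>) \<in> Omega \<phi>"
proof -
  define \<sigma> where "\<sigma> = Arg \<tau> - \<phi>"
  have "0 < norm \<tau>" using tau_nonzero by simp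
  have tau_polar: "\<tau> = of_real (norm \<tau>) * cis (\<phi> + \<sigma>)"
    using rcis_cmod_Arg[of \<tau>] by (simp add: rcis_def \<sigma>_def)
  have "cis \<phi> / cis (\<phi> + \<sigma>) = cis (- \<sigma>)"
    by (simp add: cis_divide)
  then have "cis \<phi> / \<tau> = cis (- \<sigma>) / of_real (norm \<tau>)"
    by (subst tau_polar) (metis divide_divide_eq_left')
  then have quotients: "cis \<phi> / \<tau> = cis (- \<sigma>) / of_real (norm \<tau>)"
    "\<xi> / \<tau> * cis \<phi> = \<xi> * cis (- \<sigma>) / of_real (norm \<tau>)"
    by (metis times_divide_eq_left times_divide_eq_right)+
  have "0 < \<delta> * Re (cis \<phi>)"
    using assms(1) angle rate by (auto intro!: mult_pos_pos cos_gt_zero_pi)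
  then have "\<bar>Im (\<xi> / \<tau> * cis \<phi>)\<bar> < - Im (cis \<phi> / \<tau>)"
    using exponent_gap[of "cis \<phi>"] ray_mem_sector[OF assms(1) angle(2), of 1] by simp
  then have "\<bar>Im (\<xi> * cis (- \<sigma>))\<bar> < sin \<sigma>"
    unfolding quotients using \<open>0 < norm \<tau>\<close> by (simp add: field_simps)
  then show ?thesis
    unfolding Omega_def using tau_polar \<open>0 < norm \<tau>\<close> assms(2,3) \<sigma>_def by blast
qed

end

lemma eventually_exponent_gap:
  fixes a b :: complex
  assumes "\<bar>Im a\<bar> + \<delta> < - Im b"
  shows "\<forall>\<^sub>F d in at_right 0. \<forall>t\<in>sector d. \<bar>Im (a * t)\<bar> + \<delta> * Re t \<le> - Im (b * t)"
proof -
  define L where "L = \<bar>Re a\<bar> + \<bar>Re b\<bar>"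
  have "((\<lambda>d. L * tan d) \<longlongrightarrow> L * tan 0) (at_right 0)"
    by (intro tendsto_intros) auto
  then have "\<forall>\<^sub>F d in at_right 0. L * tan d < - Im b - \<bar>Im a\<bar> - \<delta>"
    by (rule order_tendstoD) (use assms in simp)
  moreover have "\<forall>\<^sub>F d in at_right 0. d \<in> {0<..<pi/2}"
    by (intro eventually_at_right_real) auto
  ultimately show ?thesis
  proof eventually_elim
    case (elim d)
    show ?case
    proof
      fix t assume t: "t \<in> sector d"
      have "0 \<le> Re t" using Re_nonneg_sector[OF _ _ t] elim(2) by simp
      have "\<bar>Im (a * t)\<bar> + Im (b * t) \<le>
          (\<bar>Im a\<bar> + \<bar>Re a\<bar> * tan d) * Re t + (Im b + \<bar>Re b\<bar> * tan d) * Re t"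
        by (intro add_mono Im_mult_sector_le abs_Im_mult_sector_le t \<open>0 \<le> Re t\<close>)
      then have "\<bar>Im (a * t)\<bar> + Im (b * t) + \<delta> * Re t \<le> (\<bar>Im a\<bar> + Im b + \<delta> + L * tan d) * Re t"
        by (simp add: L_def algebra_simps)
      also have "\<dots> \<le> 0"
        using elim(1) \<open>0 \<le> Re t\<close> by (intro mult_nonpos_nonneg) auto
      finally show "\<bar>Im (a * t)\<bar> + \<delta> * Re t \<le> - Im (b * t)" by simp
    qed
  qed
qed

lemma strip_sector_exists:
  assumes "0 < Im \<tau>" "\<bar>Im (\<xi> / \<tau>)\<bar> < - Im (1 / \<tau>)"
  obtains d \<delta> where "strip_sector \<tau> \<xi> d \<delta>" "d < Arg \<tau>" "d < pi - Arg \<tau>"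
proof -
  obtain \<delta> where "0 < \<delta>" "\<bar>Im (\<xi> / \<tau>)\<bar> + \<delta> < - Im (1 / \<tau>)"
    using assms(2) by (metis diff_gt_0_iff_gt dense less_diff_eq add.commute)
  have "0 < Arg \<tau>" "Arg \<tau> < pi"
    using Arg_lt_pi[of \<tau>] assms(1) by auto
  then have "\<forall>\<^sub>F d in at_right 0. d \<in> {0<..<min (pi / 2) (min (Arg \<tau>) (pi - Arg \<tau>))}"
    by (intro eventually_at_right_real) auto
  with eventually_exponent_gap[OF \<open>\<bar>Im (\<xi> / \<tau>)\<bar> + \<delta> < - Im (1 / \<tau>)\<close>]
  have "\<forall>\<^sub>F d in at_right 0. strip_sector \<tau> \<xi> d \<delta> \<and> d < Arg \<tau> \<and> d < pi - Arg \<tau>"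
  proof eventually_elim
    case (elim d)
    have "strip_sector \<tau> \<xi> d \<delta>"
    proof
      show "\<bar>Im (\<xi> / \<tau> * t)\<bar> + \<delta> * Re t \<le> - Im (t / \<tau>)" if "t \<in> sector d" for t
        using bspec[OF elim(1) that] by simp
    qed (use assms(1) \<open>0 < \<delta>\<close> elim(2) in auto)
    with elim(2) show ?case by simp
  qed
  from eventually_happens'[OF _ this] show thesis
    using that by auto
qed

theorem theorem5:
  fixes P_minus P_plus :: "complex \<times> complex \<Rightarrow> complex" and \<tau> \<xi> :: complex
  assumes "is_P_minus P_minus" and "is_P_plus P_plus"
    and "0 < Im \<tau>" and "\<bar>Im (\<xi> / \<tau>)\<bar> < - Im (1 / \<tau>)"
  shows "summable (\<lambda>n. sin (2 * of_nat (Suc n) * \<xi> * of_real pi / \<tau>) /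
             (of_nat (Suc n) * (exp (2 * of_nat (Suc n) * of_real pi * \<i> / \<tau>) - 1))) \<and>
         P_minus (\<tau>, \<xi>) - P_plus (\<tau>, \<xi>) =
           2 * \<i> * (\<Sum>n. sin (2 * of_nat (Suc n) * \<xi> * of_real pi / \<tau>) /
             (of_nat (Suc n) * (exp (2 * of_nat (Suc n) * of_real pi * \<i> / \<tau>) - 1)))"
proof -
  obtain d \<delta> where "strip_sector \<tau> \<xi> d \<delta>" and d: "d < Arg \<tau>" "d < pi - Arg \<tau>"
    using strip_sector_exists[OF assms(3,4)] by blast
  then interpret strip_sector \<tau> \<xi> d \<delta> by simp
  have "(\<tau>, \<xi>) \<in> Omega (- d)" "(\<tau>, \<xi>) \<in> Omega d"
    using angle d by (auto intro!: mem_Omega)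
  then have "P_minus (\<tau>, \<xi>) = P_ray (- d) \<tau> \<xi>" "P_plus (\<tau>, \<xi>) = P_ray d \<tau> \<xi>"
    using assms(1,2) angle unfolding is_P_minus_def is_P_plus_def by fastforce+
  then show ?thesis
    using sums_mult_D[OF P_ray_difference_sums] by (simp add: sums_iff)
qed

end
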